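(* Let $$g_1(p)=e_1\,\frac{p(\bar\omega-p)}{\alpha}-e_2\,\frac{(\bar\omega-p)^2}{\alpha^2}-e_3\,\frac{p^2}{\alpha^2},$$ $$g_0(p)=e_1\,\frac{p(\omega_{\max}-p)^2}{2\alpha(\omega_{\max}-\omega_{\min})}-e_2\,\frac{(\omega_{\max}-p)^4}{4\alpha^2(\omega_{\max}-\omega_{\min})^2}-e_3\,\frac{p^2}{\alpha^2}.$$ Let $p_0^l$ be the solution of the problem of maximizing $g_1(p)$ subject to $p_b\le p\le\omega_{\min}$, and let $p_0^r$ be the solution of the problem of maximizing $g_0(p)$ subject to $\omega_{\min}\le p\le P$. Then the optimal price $p_0^*$ proposed by Formulation 0 in the asymptotic sense (defined in the context) can be obtained as follows: $p_0^*=p_0^l$ if $g_1(p_0^l)>g_0(p_0^r)$, and $p_0^*=p_0^r$ if $g_1(p_0^l)\le g_0(p_0^r)$.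
   Context: Non-discriminatory setting: a retailer charges one common unit price $p$ to $N$ consumers in a fixed time period. The preference parameters $\omega_i$ of the consumers are i.i.d. and uniformly distributed on $[\omega_{\min},\omega_{\max}]$, with expected value $\bar\omega$. $\alpha$ is a predetermined constant, $e_1,e_2,e_3$ are weight factors, and the price is constrained by $p_b\le p\le P$, where $p_b$ is the base rate and $P$ the upper price limit; the analysis treats the two intervals $[p_b,\omega_{\min}]$ and $[\omega_{\min},P]$ separately. In Formulation 0, consumer $i$'s elastic demand is $x_i=\max\big(0,\frac{\omega_i-p}{\alpha}\big)$ and the retailer maximizes, over $p_b\le p\le P$, $$f_0(p)=e_1\sum_{i=1}^N p\,x_i-\frac{e_2}{N}\Big(\sum_{i=1}^N x_i\Big)^2-e_3\sum_{i=1}^N\Big(\frac p\alpha\Big)^2.$$ "In the asymptotic sense" means that the objective is replaced by $\lim_{N\to\infty}\frac1N f_0(p)$, evaluated by the law of large numbers by taking expectations over the distribution of the $\omega_i$.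
   Formalization: The formal statement adds that the upper price limit P is at most ω_max and that α > 0; without these, g_0 and g_1 need not be the asymptotic objective and the recipe can return a non-optimal price. *)

theory Defs
  imports "HOL-Probability.Probability"
begin

definition demand :: "real \<Rightarrow> real \<Rightarrow> real \<Rightarrow> real" where
  "demand \<alpha> w p = max 0 ((w - p) / \<alpha>)"

text \<open>The consumers are numbered \<open>0, \<dots>, N - 1\<close>, and \<open>w i\<close> is the realised preference
  parameter of consumer \<open>i\<close>.\<close>

definition f0 :: "real \<Rightarrow> real \<Rightarrow> real \<Rightarrow> real \<Rightarrow> nat \<Rightarrow> (nat \<Rightarrow> real) \<Rightarrow> real \<Rightarrow> real" where
  "f0 e1 e2 e3 \<alpha> N w p =
     e1 * (\<Sum>i<N. p * demand \<alpha> (w i) p)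
     - e2 / real N * (\<Sum>i<N. demand \<alpha> (w i) p)\<^sup>2
     - e3 * (\<Sum>i<N. (p / \<alpha>)\<^sup>2)"

text \<open>The asymptotic objective \<open>F\<close> is the limit of \<open>f0 / N\<close> in the sense of the strong law of
  large numbers: for each admissible price the limit holds almost surely. On a probability space
  such a deterministic limit is unique, so \<open>F\<close> is determined on \<open>{p_b..P}\<close>, and the existential
  quantifier adds the claim that the limit exists.\<close>

definition asymptotically_optimal ::
  "'a measure \<Rightarrow> (nat \<Rightarrow> 'a \<Rightarrow> real) \<Rightarrow> real \<Rightarrow> real \<Rightarrow> real \<Rightarrow> real \<Rightarrow> real \<Rightarrow> real \<Rightarrow> real \<Rightarrow> bool"
where
  "asymptotically_optimal M \<omega> e1 e2 e3 \<alpha> p_b P p \<longleftrightarrow>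
     (\<exists>F :: real \<Rightarrow> real.
        (\<forall>q\<in>{p_b..P}. AE x in M.
           (\<lambda>N. 1 / real N * f0 e1 e2 e3 \<alpha> N (\<lambda>i. \<omega> i x) q) \<longlonglongrightarrow> F q) \<and>
        is_arg_max F (\<lambda>q. q \<in> {p_b..P}) p)"

definition g1 :: "real \<Rightarrow> real \<Rightarrow> real \<Rightarrow> real \<Rightarrow> real \<Rightarrow> real \<Rightarrow> real" where
  "g1 e1 e2 e3 \<alpha> \<omega>bar p =
     e1 * (p * (\<omega>bar - p) / \<alpha>) - e2 * ((\<omega>bar - p)\<^sup>2 / \<alpha>\<^sup>2) - e3 * (p\<^sup>2 / \<alpha>\<^sup>2)"

definition g0 :: "real \<Rightarrow> real \<Rightarrow> real \<Rightarrow> real \<Rightarrow> real \<Rightarrow> real \<Rightarrow> real \<Rightarrow> real" where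
  "g0 e1 e2 e3 \<alpha> \<omega>min \<omega>max p =
     e1 * (p * (\<omega>max - p)\<^sup>2 / (2 * \<alpha> * (\<omega>max - \<omega>min)))
     - e2 * ((\<omega>max - p) ^ 4 / (4 * \<alpha>\<^sup>2 * (\<omega>max - \<omega>min)\<^sup>2))
     - e3 * (p\<^sup>2 / \<alpha>\<^sup>2)"

end

theory Submission
  imports Defs
begin

text \<open>
  The demands of the consumers at a fixed price \<open>q\<close> are independent, identically distributed and
  bounded, so by the strong law of large numbers their average converges almost surely to the
  expected demand \<open>m q\<close> of a single consumer. The objective \<open>f0 / N\<close> is a continuous function of
  this average, namely \<open>e1 * q * m - e2 * m\<^sup>2 - e3 * (q / \<alpha>)\<^sup>2\<close>. For \<open>q \<le> \<omega>min\<close> no consumer is priced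
  out, the demand is affine in the preference and \<open>m q = (\<omega>bar - q) / \<alpha>\<close>, which turns the limit into
  \<open>g1\<close>; for \<open>\<omega>min \<le> q \<le> \<omega>max\<close> an integration over \<open>{q..\<omega>max}\<close> gives
  \<open>m q = (\<omega>max - q)\<^sup>2 / (2 * \<alpha> * (\<omega>max - \<omega>min))\<close>, which turns it into \<open>g0\<close>. Hence the limit objective
  agrees with \<open>g1\<close> on the left interval and with \<open>g0\<close> on the right one, the two formulas coinciding
  at the common end point \<open>\<omega>min\<close>, and its maximum is the larger of the two partial maxima.

  Because demands are bounded, the strong law needs no truncation argument: Hoeffding's inequality
  makes the probabilities of an \<open>\<epsilon>\<close>-deviation geometrically small, and the Borel--Cantelli lemma
  does the rest.
\<close>

text \<open>The tails furnished by Hoeffding's inequality form a geometric series, so almost surely only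
  finitely many averages deviate by more than a given \<open>\<epsilon>\<close>; letting \<open>\<epsilon>\<close> run through \<open>1 / (k + 1)\<close>
  keeps the exceptional set null.\<close>

lemma (in prob_space) strong_law_bounded:
  fixes X :: "nat \<Rightarrow> 'a \<Rightarrow> real"
  assumes indep: "indep_vars (\<lambda>_. borel) X UNIV"
    and bounded: "\<And>i. AE x in M. X i x \<in> {a..b}"
    and mean: "\<And>i. expectation (X i) = \<mu>"
  shows "AE x in M. (\<lambda>n. (\<Sum>i<n. X i x) / real n) \<longlonglongrightarrow> \<mu>"
proof -
  \<comment> \<open>Hoeffding's inequality needs an interval of positive length.\<close>
  define c where "c = max b (a + 1)"
  define d where "d = c - a"
  have d: "d > 0" by (simp add: d_def c_def)
  have [measurable]: "random_variable borel (X i)" for i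
    using indep unfolding indep_vars_def by blast
  define A where
    "A k n = {x\<in>space M. \<bar>(\<Sum>i<n. X i x) - real n * \<mu>\<bar> \<ge> real n / real (Suc k)}" for k n
  have A_meas: "A k n \<in> sets M" for k n
    unfolding A_def by measurable
  have A_bound: "prob (A k n) \<le> 2 * exp (- 2 / ((real (Suc k))\<^sup>2 * d\<^sup>2)) ^ n" for k n
  proof (cases "n = 0")
    case True
    then show ?thesis using order_trans[OF prob_le_1[of "A k n"], of 2] by simp
  next
    case False
    have "AE x in M. X i x \<in> {a..c}" for i
      using bounded[of i] by eventually_elim (auto simp: c_def)
    then interpret Hoeffding_ineq M "{..<n}" X "\<lambda>_. a" "\<lambda>_. c" "\<Sum>i<n. expectation (X i)"
      by unfold_locales (auto intro: indep_vars_subset[OF indep])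
    have pos: "(\<Sum>i<n. (c - a)\<^sup>2) > 0"
      using d False by (simp add: d_def)
    have exponent: "-2 * (real n / real (Suc k))\<^sup>2 / (real n * d\<^sup>2)
        = real n * (- 2 / ((real (Suc k))\<^sup>2 * d\<^sup>2))"
      using False d by (simp add: power2_eq_square divide_simps del: of_nat_Suc)
    have "prob (A k n) \<le> 2 * exp (-2 * (real n / real (Suc k))\<^sup>2 / (real n * d\<^sup>2))"
      using Hoeffding_ineq_abs_ge[OF _ pos, of "real n / real (Suc k)"]
      by (simp add: A_def mean d_def del: of_nat_Suc)
    then show ?thesis
      unfolding exponent by (simp only: exp_of_nat_mult)
  qed
  have "AE x in M. eventually (\<lambda>n. x \<in> space M - A k n) sequentially" for k
  proof (rule borel_cantelli_AE1[OF A_meas])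
    have "norm (exp (- 2 / ((real (Suc k))\<^sup>2 * d\<^sup>2))) < 1"
      using d by (simp del: of_nat_Suc)
    then have "summable (\<lambda>n. 2 * exp (- 2 / ((real (Suc k))\<^sup>2 * d\<^sup>2)) ^ n)"
      by (intro summable_mult summable_geometric)
    then show "summable (\<lambda>n. prob (A k n))"
      by (rule summable_comparison_test') (use A_bound in auto)
  qed (simp add: emeasure_eq_measure)
  then have "AE x in M. \<forall>k. eventually (\<lambda>n. x \<in> space M - A k n) sequentially"
    by (simp add: AE_all_countable)
  then show ?thesis
  proof eventually_elim
    case (elim x)
    show ?case
    proof (rule LIMSEQ_I)
      fix r :: real assume "r > 0"
      then obtain k where k: "inverse (real (Suc k)) < r"
        using reals_Archimedean by blast
      have "eventually (\<lambda>n. norm ((\<Sum>i<n. X i x) / real n - \<mu>) < r) sequentially"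
        using elim[rule_format, of k] eventually_gt_at_top[of 0]
      proof eventually_elim
        case (elim n)
        then have "\<bar>(\<Sum>i<n. X i x) - real n * \<mu>\<bar> < real n / real (Suc k)"
          by (auto simp: A_def)
        moreover have "\<bar>(\<Sum>i<n. X i x) - real n * \<mu>\<bar>
            = real n * \<bar>(\<Sum>i<n. X i x) / real n - \<mu>\<bar>"
          using elim by (simp add: abs_mult[symmetric, of "real n", simplified] field_simps)
        ultimately have "real n * \<bar>(\<Sum>i<n. X i x) / real n - \<mu>\<bar> < real n * inverse (real (Suc k))"
          by (simp add: divide_inverse)
        with elim k show ?case
          by (simp del: of_nat_Suc)
      qed
      then show "\<exists>no. \<forall>n\<ge>no. norm ((\<Sum>i<n. X i x) / real n - \<mu>) < r"
        by (simp add: eventually_sequentially)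
    qed
  qed
qed

lemma uniform_measure_Icc_eq_density:
  fixes a b :: real
  assumes "a < b"
  shows "uniform_measure lborel {a..b} = density lborel (\<lambda>x. ennreal (indicator {a..b} x / (b - a)))"
  unfolding uniform_measure_def using assms
  by (intro density_cong) (auto simp: divide_ennreal ennreal_indicator[symmetric]
        simp del: ennreal_indicator split: split_indicator)

lemma demand_borel_measurable [measurable]: "(\<lambda>w. demand \<alpha> w q) \<in> borel_measurable borel"
  unfolding demand_def by measurable

lemma demand_mono: "\<alpha> > 0 \<Longrightarrow> w \<le> w' \<Longrightarrow> demand \<alpha> w q \<le> demand \<alpha> w' q"
  unfolding demand_def by (intro max.mono divide_right_mono) auto

text \<open>Only preferences in \<open>{q..b}\<close> contribute, and there the demand has the antiderivative
  \<open>(w - q)\<^sup>2 / (2 * \<alpha>)\<close>.\<close>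

lemma expected_demand_uniform_truncated:
  fixes a b q :: real
  assumes "a < b" "\<alpha> > 0" "a \<le> q" "q \<le> b"
  shows "(\<integral>w. demand \<alpha> w q \<partial>uniform_measure lborel {a..b}) = (b - q)\<^sup>2 / (2 * \<alpha> * (b - a))"
proof -
  have "(\<integral>w. demand \<alpha> w q \<partial>uniform_measure lborel {a..b})
      = (\<integral>w. indicator {a..b} w / (b - a) * demand \<alpha> w q \<partial>lborel)"
    unfolding uniform_measure_Icc_eq_density[OF assms(1)]
    using assms(1) by (subst integral_density) auto
  also have "\<dots> = (\<integral>w. (w - q) / (\<alpha> * (b - a)) * indicator {q..b} w \<partial>lborel)"
    using assms
    by (intro Bochner_Integration.integral_cong)
      (auto simp: demand_def max_def field_simps split: split_indicator)
  also have "\<dots> = (b - q)\<^sup>2 / (2 * \<alpha> * (b - a)) - (q - q)\<^sup>2 / (2 * \<alpha> * (b - a))"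
  proof (rule integral_FTC_Icc_real)
    fix w :: real
    have "((\<lambda>w. (w - q)\<^sup>2) has_real_derivative 2 * (w - q)) (at w)"
      by (auto intro!: derivative_eq_intros)
    from DERIV_cdivide[OF this, of "2 * \<alpha> * (b - a)"]
    show "((\<lambda>w. (w - q)\<^sup>2 / (2 * \<alpha> * (b - a))) has_real_derivative (w - q) / (\<alpha> * (b - a))) (at w)"
      by (simp only: mult.assoc mult_divide_mult_cancel_left[OF zero_neq_numeral[symmetric]])
  qed (use assms in auto)
  finally show ?thesis by simp
qed

lemma f0_div_N_eq:
  assumes "N > 0"
  shows "1 / real N * f0 e1 e2 e3 \<alpha> N w q =
    e1 * (q * ((\<Sum>i<N. demand \<alpha> (w i) q) / real N))
    - e2 * ((\<Sum>i<N. demand \<alpha> (w i) q) / real N)\<^sup>2 - e3 * (q / \<alpha>)\<^sup>2"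
  using assms unfolding f0_def sum_distrib_left[symmetric]
  by (simp add: field_simps power2_eq_square)

lemma is_arg_max_glue:
  fixes F :: "real \<Rightarrow> real"
  assumes l: "is_arg_max g (\<lambda>p. p \<in> {a..b}) pl" and r: "is_arg_max h (\<lambda>p. p \<in> {b..c}) pr"
    and Fl: "\<And>q. q \<in> {a..b} \<Longrightarrow> F q = g q" and Fr: "\<And>q. q \<in> {b..c} \<Longrightarrow> F q = h q"
  shows "is_arg_max F (\<lambda>p. p \<in> {a..c}) (if g pl > h pr then pl else pr)"
proof -
  have pl: "pl \<in> {a..b}" "\<And>q. q \<in> {a..b} \<Longrightarrow> g q \<le> g pl"
    using l by (auto simp: is_arg_max_linorder)
  have pr: "pr \<in> {b..c}" "\<And>q. q \<in> {b..c} \<Longrightarrow> h q \<le> h pr"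
    using r by (auto simp: is_arg_max_linorder)
  have "F q \<le> max (g pl) (h pr)" if "q \<in> {a..c}" for q
  proof (cases "q \<le> b")
    case True
    with that pl(2)[of q] Fl[of q] show ?thesis by auto
  next
    case False
    with that pr(2)[of q] Fr[of q] show ?thesis by auto
  qed
  moreover have "F pl = g pl" "F pr = h pr"
    using Fl Fr pl(1) pr(1) by auto
  ultimately show ?thesis
    using pl(1) pr(1) by (fastforce simp: is_arg_max_linorder max_def split: if_splits)
qed

theorem mainTheorem4:
  fixes M :: "'a measure" and \<omega> :: "nat \<Rightarrow> 'a \<Rightarrow> real"
    and e1 e2 e3 \<alpha> \<omega>min \<omega>max \<omega>bar p_b P p0l p0r :: real
  assumes "prob_space M"
    and "prob_space.indep_vars M (\<lambda>_. borel) \<omega> UNIV"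
    and "\<omega>min < \<omega>max"
    and "\<And>i. distr M borel (\<omega> i) = uniform_measure lborel {\<omega>min..\<omega>max}"
    and "\<And>i. prob_space.expectation M (\<omega> i) = \<omega>bar"
    and "\<alpha> > 0"
    and "P \<le> \<omega>max"
    and "is_arg_max (g1 e1 e2 e3 \<alpha> \<omega>bar) (\<lambda>p. p \<in> {p_b..\<omega>min}) p0l"
    and "is_arg_max (g0 e1 e2 e3 \<alpha> \<omega>min \<omega>max) (\<lambda>p. p \<in> {\<omega>min..P}) p0r"
  shows "asymptotically_optimal M \<omega> e1 e2 e3 \<alpha> p_b P
           (if g1 e1 e2 e3 \<alpha> \<omega>bar p0l > g0 e1 e2 e3 \<alpha> \<omega>min \<omega>max p0r then p0l else p0r)"
proof -
  interpret prob_space M by fact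
  have \<omega>_meas [measurable]: "random_variable borel (\<omega> i)" for i
    using assms(2) unfolding indep_vars_def by blast
  have \<omega>_range: "AE x in M. \<omega> i x \<in> {\<omega>min..\<omega>max}" for i
  proof -
    have "AE w in distr M borel (\<omega> i). w \<in> {\<omega>min..\<omega>max}"
      unfolding assms(4) by (rule AE_uniform_measureI) auto
    then show ?thesis
      by (subst (asm) AE_distr_iff) auto
  qed
  have \<omega>_integrable: "integrable M (\<omega> i)" for i
  proof (rule integrable_const_bound)
    show "AE x in M. norm (\<omega> i x) \<le> max \<bar>\<omega>min\<bar> \<bar>\<omega>max\<bar>"
      using \<omega>_range[of i] by eventually_elim auto
  qed simp

  \<comment> \<open>One formula for the limit at every price: \<open>g1\<close> and \<open>g0\<close> are two evaluations of it at
    \<open>\<omega>min\<close>, so they agree there without computing \<open>\<omega>bar\<close>.\<close>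
  define m where "m q = (\<integral>w. demand \<alpha> w q \<partial>uniform_measure lborel {\<omega>min..\<omega>max})" for q
  define F where "F q = e1 * (q * m q) - e2 * (m q)\<^sup>2 - e3 * (q / \<alpha>)\<^sup>2" for q
  have expected_demand: "expectation (\<lambda>x. demand \<alpha> (\<omega> i x) q) = m q" for i q
    unfolding m_def assms(4)[of i, symmetric] by (subst integral_distr) auto

  have limit: "AE x in M. (\<lambda>N. 1 / real N * f0 e1 e2 e3 \<alpha> N (\<lambda>i. \<omega> i x) q) \<longlonglongrightarrow> F q" for q
  proof -
    have "AE x in M. (\<lambda>n. (\<Sum>i<n. demand \<alpha> (\<omega> i x) q) / real n) \<longlonglongrightarrow> m q"
    proof (rule strong_law_bounded)
      show "indep_vars (\<lambda>_. borel) (\<lambda>i x. demand \<alpha> (\<omega> i x) q) UNIV"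
        by (rule indep_vars_compose2[OF assms(2)]) auto
      show "AE x in M. demand \<alpha> (\<omega> i x) q \<in> {demand \<alpha> \<omega>min q..demand \<alpha> \<omega>max q}" for i
        using \<omega>_range[of i] by eventually_elim (auto intro: demand_mono[OF \<open>\<alpha> > 0\<close>])
    qed (rule expected_demand)
    then show ?thesis
    proof eventually_elim
      case (elim x)
      show ?case
      proof (rule Lim_transform_eventually)
        show "(\<lambda>N. e1 * (q * ((\<Sum>i<N. demand \<alpha> (\<omega> i x) q) / real N))
            - e2 * ((\<Sum>i<N. demand \<alpha> (\<omega> i x) q) / real N)\<^sup>2 - e3 * (q / \<alpha>)\<^sup>2) \<longlonglongrightarrow> F q"
          unfolding F_def by (intro tendsto_intros elim)
        show "eventually (\<lambda>N. e1 * (q * ((\<Sum>i<N. demand \<alpha> (\<omega> i x) q) / real N))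
            - e2 * ((\<Sum>i<N. demand \<alpha> (\<omega> i x) q) / real N)\<^sup>2 - e3 * (q / \<alpha>)\<^sup>2
            = 1 / real N * f0 e1 e2 e3 \<alpha> N (\<lambda>i. \<omega> i x) q) sequentially"
          using eventually_gt_at_top[of 0] by eventually_elim (simp only: f0_div_N_eq)
      qed
    qed
  qed

  have left: "F q = g1 e1 e2 e3 \<alpha> \<omega>bar q" if "q \<le> \<omega>min" for q
  proof -
    have "AE x in M. demand \<alpha> (\<omega> 0 x) q = (\<omega> 0 x - q) / \<alpha>"
      using \<omega>_range[of 0]
      by eventually_elim (use that \<open>\<alpha> > 0\<close> in \<open>auto simp: demand_def\<close>)
    then have "m q = expectation (\<lambda>x. (\<omega> 0 x - q) / \<alpha>)"
      unfolding expected_demand[of 0 q, symmetric] by (intro integral_cong_AE) auto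
    also have "\<dots> = (\<omega>bar - q) / \<alpha>"
      using \<omega>_integrable[of 0] by (simp add: assms(5) prob_space)
    finally show ?thesis
      by (simp add: F_def g1_def power_divide)
  qed

  have right: "F q = g0 e1 e2 e3 \<alpha> \<omega>min \<omega>max q" if "\<omega>min \<le> q" "q \<le> P" for q
  proof -
    have "m q = (\<omega>max - q)\<^sup>2 / (2 * \<alpha> * (\<omega>max - \<omega>min))"
      unfolding m_def using that assms by (intro expected_demand_uniform_truncated) auto
    then show ?thesis
      by (simp add: F_def g0_def power_divide power_mult_distrib power_mult[symmetric])
  qed

  have "is_arg_max F (\<lambda>q. q \<in> {p_b..P})
      (if g1 e1 e2 e3 \<alpha> \<omega>bar p0l > g0 e1 e2 e3 \<alpha> \<omega>min \<omega>max p0r then p0l else p0r)"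
    by (rule is_arg_max_glue[OF assms(8,9)]) (auto simp: left right)
  with limit show ?thesis
    unfolding asymptotically_optimal_def by blast
qed

end
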